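(* Let $w$ be a permutation that avoids the pattern $1423$ (i.e. $p_{1423}(w)=0$). Then $c_w(\beta)\in\mathbb{Z}_{\ge 0}[\beta]$. Equivalently, $\Upsilon_w(\beta)=\sum_{v} c_v(\beta)\,p_v(w)$ with all $c_v(\beta)$ appearing (namely those $v$ with $p_v(w)>0$) having nonnegative integer coefficients.
   Context: $S_n$ is the set of permutations of $\{1,\dots,n\}$ in one-line notation $w=w(1)\cdots w(n)$; $S_0=\{\emptyset\}$. For $w\in S_n$, the $\beta$-Grothendieck polynomial $\mathfrak{G}^{(\beta)}_w(x)\in\mathbb{Z}[\beta][x_1,\dots,x_n]$ is defined by $\mathfrak{G}^{(\beta)}_{w_0}=x_1^{n-1}x_2^{n-2}\cdots x_{n-1}$ for $w_0=n\cdots21$, and $\mathfrak{G}^{(\beta)}_w=\pi_i\,\mathfrak{G}^{(\beta)}_{ws_i}$ whenever $w(i)<w(i+1)$, where $ws_i$ swaps the entries in positions $i,i+1$, $\pi_i(f)=\partial_i\big((1+\beta x_{i+1})f\big)$ and $\partial_i f=(f-s_if)/(x_i-x_{i+1})$ with $s_i$ swapping $x_i,x_{i+1}$ (this is independent of choices). The principal specialization is $\Upsilon_w(\beta)=\mathfrak{G}^{(\beta)}_w(1,\dots,1)$, with $\Upsilon_\emptyset(\beta)=1$. All words have distinct positive integer entries. For words $u,v$, $u\le v$ means $u$ is a subword (subsequence) of $v$; $\emptyset\le v$ always; $|v|$ is the number of entries. $\mathrm{perm}(v)$ is the permutation with entries in the same relative order as $v$ (e.g. $\mathrm{perm}(2574)=1342$).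 For $u\in S_m$, $w\in S_n$, $p_u(w)$ is the number of subwords $v\le w$ (i.e. choices of positions) with $\mathrm{perm}(v)=u$; $p_\emptyset(w)=1$; $w$ avoids $u$ if $p_u(w)=0$. Define $c_w(\beta)=\sum_{\emptyset\le v\le w}(-1)^{|w|-|v|}\Upsilon_{\mathrm{perm}(v)}(\beta)$, the sum over all subwords of $w$ (one for each subset of positions); equivalently $c_\emptyset(\beta)=1$ and $c_w(\beta)=\Upsilon_w(\beta)-\sum_{v\in S_m,\,0\le m<n}c_v(\beta)p_v(w)$. *)

theory Defs
  imports "HOL-Library.Poly_Mapping" "HOL-Computational_Algebra.Polynomial"
begin

definition is_perm :: "nat list \<Rightarrow> bool" where
  "is_perm w \<longleftrightarrow> distinct w \<and> set w = {1..length w}"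

definition std :: "nat list \<Rightarrow> nat list" where
  "std v = map (\<lambda>x. card {y \<in> set v. y \<le> x}) v"

definition patt_count :: "nat list \<Rightarrow> nat list \<Rightarrow> nat" where
  "patt_count u w = card {S. S \<subseteq> {..<length w} \<and> std (nths w S) = u}"

type_synonym mpoly = "(nat \<Rightarrow>\<^sub>0 nat) \<Rightarrow>\<^sub>0 int poly"

definition Xv :: "nat \<Rightarrow> mpoly" where
  "Xv j = Poly_Mapping.single (Poly_Mapping.single j 1) 1"

definition betaC :: mpoly where
  "betaC = Poly_Mapping.single 0 [:0, 1:]"

definition swap_idx :: "nat \<Rightarrow> nat \<Rightarrow> nat" where
  "swap_idx i j = (if j = i then Suc i else if j = Suc i then i else j)"

definition swap_vars :: "nat \<Rightarrow> mpoly \<Rightarrow> mpoly" where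
  "swap_vars i f = (\<Sum>m\<in>Poly_Mapping.keys f.
      Poly_Mapping.single (Poly_Mapping.map_key (swap_idx i) m) (Poly_Mapping.lookup f m))"

definition divdiff :: "nat \<Rightarrow> mpoly \<Rightarrow> mpoly" where
  "divdiff i f = (THE g. (Xv i - Xv (Suc i)) * g = f - swap_vars i f)"

definition pi_op :: "nat \<Rightarrow> mpoly \<Rightarrow> mpoly" where
  "pi_op i f = divdiff i ((1 + betaC * Xv (Suc i)) * f)"

text \<open>The top polynomial x_1^(n-1) x_2^(n-2) ... x_(n-1) (variables shifted to 0-based).\<close>
definition groth_top :: "nat \<Rightarrow> mpoly" where
  "groth_top n = (\<Prod>j<n. Xv j ^ (n - 1 - j))"

definition swap_pos :: "nat list \<Rightarrow> nat \<Rightarrow> nat list" where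
  "swap_pos w i = w[i := w ! Suc i, Suc i := w ! i]"

definition has_ascent :: "nat list \<Rightarrow> bool" where
  "has_ascent w \<longleftrightarrow> (\<exists>i. Suc i < length w \<and> w ! i < w ! Suc i)"

definition first_ascent :: "nat list \<Rightarrow> nat" where
  "first_ascent w = (LEAST i. Suc i < length w \<and> w ! i < w ! Suc i)"

text \<open>Recursion G_w = pi_i G_(w s_i) for an ascent i (we always use the first ascent);
  G_(w0) is the top monomial.  The fuel argument k is large enough (length w squared
  exceeds the number of non-inversions), so the fuel never runs out.\<close>
fun groth_aux :: "nat \<Rightarrow> nat \<Rightarrow> nat list \<Rightarrow> mpoly" where
  "groth_aux n 0 w = groth_top n"
| "groth_aux n (Suc k) w =
     (if has_ascent w
      then pi_op (first_ascent w) (groth_aux n k (swap_pos w (first_ascent w)))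
      else groth_top n)"

definition grothendieck :: "nat list \<Rightarrow> mpoly" where
  "grothendieck w = groth_aux (length w) (length w ^ 2) w"

definition eval_ones :: "mpoly \<Rightarrow> int poly" where
  "eval_ones f = (\<Sum>m\<in>Poly_Mapping.keys f. Poly_Mapping.lookup f m)"

definition Upsilon :: "nat list \<Rightarrow> int poly" where
  "Upsilon w = eval_ones (grothendieck w)"

definition cw :: "nat list \<Rightarrow> int poly" where
  "cw w = (\<Sum>S\<in>Pow {..<length w}.
      (-1) ^ (length w - card S) * Upsilon (std (nths w S)))"

end

(* Grothendieck polynomials are read off the 0-Hecke product G_n = G' C, where C = (1 + x_1 u_1) ...
   (1 + x_(n-1) u_(n-1)) is the first column of the pipe dreams and G' is G_(n-1) with the generators
   shifted but the variables unchanged.  At x = 1 this expresses the value at P a Q, a being the least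
   letter, by words P Q', where Q' arises from Q by moving letters to the left across larger ones.

   In the alternating sum over subwords, deleting a cancels the term Q' = Q.  A move in which m crosses
   from z_1 to z_r is compatible with the presence or absence of every other letter, unless
   there is an unmoved letter z < m between them.  This letter would be the 2 of the pattern
   a z_r z m = 1423.  The induction therefore
   runs over sums restricted to subwords that contain a set of marked letters, under the invariant that the
   2 of every 1423 is marked.  All letters taking part in a move become marked; this keeps the
   invariant although the moves themselves create new occurrences of 1423, and a marked obstacle z
   merely makes the term vanish.  So no negative sign ever appears. *)

theory Submission
  imports Defs "HOL-Library.Sublist"
begin

subsection \<open>The 0-Hecke action on words\<close>

lemma length_swap_pos [simp]: "length (swap_pos w i) = length w"
  by (simp add: swap_pos_def)

lemma swap_pos_append: "swap_pos (p @ a # b # q) (length p) = p @ b # a # q"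
  by (simp add: swap_pos_def list_update_append nth_append)

lemma nth_swap_pos:
  "Suc i < length w \<Longrightarrow> swap_pos w i ! k = (if k = i then w ! Suc i else if k = Suc i then w ! i else w ! k)"
  by (auto simp: swap_pos_def nth_list_update)

lemma mset_swap_pos [simp]: "Suc i < length w \<Longrightarrow> mset (swap_pos w i) = mset w"
  by (simp add: swap_pos_def mset_swap)

lemma distinct_swap_pos [simp]: "Suc i < length w \<Longrightarrow> distinct (swap_pos w i) = distinct w"
  using mset_swap_pos mset_eq_imp_distinct_iff by blast

lemma set_swap_pos [simp]: "Suc i < length w \<Longrightarrow> set (swap_pos w i) = set w"
  by (metis mset_swap_pos set_mset_mset)

lemma swap_pos_swap_pos [simp]: "Suc i < length w \<Longrightarrow> swap_pos (swap_pos w i) i = w"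
  by (rule nth_equalityI) (auto simp: nth_swap_pos)

lemma swap_pos_commute:
  "\<lbrakk>Suc i < length w; Suc j < length w; Suc i < j \<or> Suc j < i\<rbrakk>
    \<Longrightarrow> swap_pos (swap_pos w i) j = swap_pos (swap_pos w j) i"
  by (rule nth_equalityI) (auto simp: nth_swap_pos)

lemma swap_pos_braid:
  "Suc (Suc i) < length w
    \<Longrightarrow> swap_pos (swap_pos (swap_pos w i) (Suc i)) i = swap_pos (swap_pos (swap_pos w (Suc i)) i) (Suc i)"
  by (rule nth_equalityI) (auto simp: nth_swap_pos)

text \<open>A function \<open>f\<close> on words encodes \<open>\<Sum>\<^sub>w f(w) u\<^sub>w\<close>; then \<open>hecke b i f\<close> encodes
  its product with \<open>u\<^sub>i\<close> on the right, where \<open>u\<^sub>i\<^sup>2 = b u\<^sub>i\<close>.\<close>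

definition hecke :: "'a::comm_ring_1 \<Rightarrow> nat \<Rightarrow> (nat list \<Rightarrow> 'a) \<Rightarrow> nat list \<Rightarrow> 'a" where
  "hecke b i f w = (if w ! Suc i < w ! i then f (swap_pos w i) + b * f w else 0)"

lemma hecke_quadratic:
  "\<lbrakk>distinct w; Suc i < length w\<rbrakk> \<Longrightarrow> hecke b i (hecke b i f) w = b * hecke b i f w"
  by (simp add: hecke_def nth_swap_pos)

lemma hecke_commute:
  assumes "Suc i < length w" "Suc j < length w" "Suc i < j \<or> Suc j < i"
  shows "hecke b i (hecke b j f) w = hecke b j (hecke b i f) w"
proof -
  have "i \<noteq> j" "i \<noteq> Suc j" "j \<noteq> Suc i" using assms(3) by auto
  moreover have "swap_pos (swap_pos w i) j = swap_pos (swap_pos w j) i"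
    using assms by (rule swap_pos_commute)
  ultimately show ?thesis
    using assms(1,2) by (simp add: hecke_def nth_swap_pos distrib_left mult.left_commute add_ac)
qed

lemma hecke_braid:
  assumes "distinct w" "Suc (Suc i) < length w"
  shows "hecke b i (hecke b (Suc i) (hecke b i f)) w = hecke b (Suc i) (hecke b i (hecke b (Suc i) f)) w"
proof -
  have "w ! i \<noteq> w ! Suc i" "w ! i \<noteq> w ! Suc (Suc i)" "w ! Suc i \<noteq> w ! Suc (Suc i)"
    using assms by (simp_all add: nth_eq_iff_index_eq)
  then consider "w ! i < w ! Suc i" "w ! Suc i < w ! Suc (Suc i)"
    | "w ! i < w ! Suc (Suc i)" "w ! Suc (Suc i) < w ! Suc i"
    | "w ! Suc i < w ! i" "w ! i < w ! Suc (Suc i)"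
    | "w ! Suc i < w ! Suc (Suc i)" "w ! Suc (Suc i) < w ! i"
    | "w ! Suc (Suc i) < w ! i" "w ! i < w ! Suc i"
    | "w ! Suc (Suc i) < w ! Suc i" "w ! Suc i < w ! i"
    by linarith
  then show ?thesis
    using assms(2)
    by cases (simp_all add: hecke_def nth_swap_pos swap_pos_braid distrib_left add_ac)
qed

text \<open>Right multiplication by (1 + x_0 u_0) ... (1 + x_(n-1) u_(n-1)); the factor of largest
  index is the outermost step of the recursion.\<close>

primrec columns :: "'a::comm_ring_1 \<Rightarrow> (nat \<Rightarrow> 'a) \<Rightarrow> (nat list \<Rightarrow> 'a) \<Rightarrow> nat \<Rightarrow> nat list \<Rightarrow> 'a" where
  "columns b x f 0 w = f w"
| "columns b x f (Suc j) w = columns b x f j w + x j * hecke b j (columns b x f j) w"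

text \<open>Shifts each generator u_i to u_(i+1): the result is supported on words that begin with
  their least letter.\<close>

definition lift_min :: "(nat list \<Rightarrow> 'a::comm_ring_1) \<Rightarrow> nat list \<Rightarrow> 'a" where
  "lift_min f w = (if \<forall>y\<in>set (tl w). hd w < y then f (tl w) else 0)"

text \<open>At \<open>betaC\<close> and \<open>Xv\<close> these coefficients turn out to be the
  Grothendieck polynomials; general \<open>b\<close> and \<open>x\<close> leave room for
  specialization.\<close>

primrec gpoly :: "'a::comm_ring_1 \<Rightarrow> (nat \<Rightarrow> 'a) \<Rightarrow> nat \<Rightarrow> nat list \<Rightarrow> 'a" where
  "gpoly b x 0 w = 1"
| "gpoly b x (Suc n) w = columns b x (lift_min (gpoly b x n)) n w"

text \<open>Instantiated by the exchange of two variables and by evaluation at ones.\<close>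

locale comm_ring_hom =
  fixes h :: "'a::comm_ring_1 \<Rightarrow> 'c::comm_ring_1"
  assumes hom_add: "h (f + g) = h f + h g"
    and hom_mult: "h (f * g) = h f * h g"
    and hom_one: "h 1 = 1"
begin

lemma hom_zero: "h 0 = 0"
  using hom_add[of 0 0] by simp

lemma hom_columns:
  assumes "\<And>w. h (f w) = g w"
  shows "h (columns b x f n w) = columns (h b) (\<lambda>i. h (x i)) g n w"
  by (induction n arbitrary: w) (auto simp: assms hecke_def hom_add hom_mult hom_zero)

lemma hom_gpoly: "h (gpoly b x n w) = gpoly (h b) (\<lambda>i. h (x i)) n w"
  by (induction n arbitrary: w)
    (auto simp: hom_one lift_min_def hom_zero intro!: hom_columns)

end

lemma columns_cong:
  assumes "\<And>j. j < n \<Longrightarrow> x j = y j"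
  shows "columns b x f n = columns b y f n"
  using assms
proof (induction n)
  case (Suc n)
  then have "columns b x f n = columns b y f n" "x n = y n" by simp_all
  then show ?case by (intro ext) simp
qed (simp add: fun_eq_iff)

text \<open>On n letters only x_0, ..., x_(n-2) occur. This settles the case of
  \<open>exch_gpoly\<close> where the smaller product contains neither exchanged variable.\<close>

lemma gpoly_cong:
  assumes "\<And>j. Suc j < n \<Longrightarrow> x j = y j"
  shows "gpoly b x n = gpoly b y n"
  using assms
proof (induction n)
  case (Suc n)
  have "gpoly b x n = gpoly b y n" by (rule Suc.IH) (simp add: Suc.prems)
  moreover have "columns b x f n = columns b y f n" for f
    by (rule columns_cong) (simp add: Suc.prems)
  ultimately show ?case by (intro ext) simp
qed (simp add: fun_eq_iff)

subsection \<open>Symmetry under exchange of variables\<close>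

lemma hecke_lift_min:
  assumes "length w = Suc n" "Suc i < n"
  shows "hecke b (Suc i) (lift_min f) w = (if \<forall>y\<in>set (tl w). hd w < y then hecke b i f (tl w) else 0)"
proof -
  obtain a v where w: "w = a # v" using assms by (cases w) auto
  have s: "swap_pos (a # v) (Suc i) = a # swap_pos v i"
    by (simp add: swap_pos_def)
  show ?thesis using assms by (simp add: w hecke_def lift_min_def s)
qed

text \<open>The relation \<open>(1 + b x\<^sub>i) s\<^sub>i G = G (1 + b x\<^sub>i - (x\<^sub>i - x\<^sub>i\<^sub>+\<^sub>1) u\<^sub>i)\<close> for the
  action of the 0-Hecke algebra, where \<open>G\<close> is a function on words of length \<open>N\<close>.\<close>

definition exch :: "('a::comm_ring_1 \<Rightarrow> 'a) \<Rightarrow> 'a \<Rightarrow> 'a \<Rightarrow> 'a \<Rightarrow> nat \<Rightarrow> nat \<Rightarrow> (nat list \<Rightarrow> 'a) \<Rightarrow> bool" where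
  "exch s b p q N i f \<longleftrightarrow> (\<forall>w. distinct w \<longrightarrow> length w = N \<longrightarrow>
     (1 + b * p) * s (f w) = (1 + b * p) * f w - (p - q) * hecke b i f w)"

lemma hecke_cong:
  assumes "distinct w" "length w = N" "Suc i < N"
    "\<And>w. distinct w \<Longrightarrow> length w = N \<Longrightarrow> f w = g w"
  shows "hecke b i f w = hecke b i g w"
  using assms by (simp add: hecke_def)

lemma hecke_add: "hecke b i (\<lambda>w. f w + g w) w = hecke b i f w + hecke b i g w"
  by (simp add: hecke_def algebra_simps)

lemma hecke_cmult: "hecke b i (\<lambda>w. c * f w) w = c * hecke b i f w"
  by (simp add: hecke_def algebra_simps)

lemma hecke_diff: "hecke b i (\<lambda>w. f w - g w) w = hecke b i f w - hecke b i g w"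
  by (simp add: hecke_def algebra_simps)

context
  fixes s :: "'a::comm_ring_1 \<Rightarrow> 'a" and b :: 'a
  assumes s: "comm_ring_hom s" and sb: "s b = b"
begin

interpretation comm_ring_hom s by (rule s)

lemma hom_hecke: "s (hecke b i f w) = hecke b i (\<lambda>w. s (f w)) w"
  by (simp add: hecke_def hom_add hom_mult hom_zero sb)

text \<open>The factor 1 + x u_j commutes with u_i and is fixed by \<open>s\<close>, so it can be
  appended on both sides of the relation.\<close>

lemma exch_far:
  assumes e: "exch s b p q N i f" and x: "s x = x"
    and j: "Suc j < i \<or> Suc i < j" "Suc i < N" "Suc j < N"
  shows "exch s b p q N i (\<lambda>w. f w + x * hecke b j f w)"
  unfolding exch_def
proof (intro allI impI)
  fix w :: "nat list"
  assume w: "distinct w" "length w = N"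
  let ?e = "1 + b * p"
  have 1: "?e * s (f w) = ?e * f w - (p - q) * hecke b i f w"
    using e w unfolding exch_def by blast
  have "?e * s (hecke b j f w) = hecke b j (\<lambda>w. ?e * s (f w)) w"
    by (simp only: hom_hecke hecke_cmult)
  also have "\<dots> = hecke b j (\<lambda>w. ?e * f w - (p - q) * hecke b i f w) w"
    using e w j by (intro hecke_cong[of w N]) (auto simp: exch_def)
  also have "\<dots> = ?e * hecke b j f w - (p - q) * hecke b i (hecke b j f) w"
    using w j by (simp only: hecke_diff hecke_cmult) (subst hecke_commute, auto)
  finally have 2: "?e * s (hecke b j f w) = \<dots>" .
  have "?e * s (f w + x * hecke b j f w) = ?e * s (f w) + x * (?e * s (hecke b j f w))"
    by (simp add: hom_add hom_mult x algebra_simps)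
  also have "\<dots> = ?e * (f w + x * hecke b j f w)
      - (p - q) * (hecke b i f w + x * hecke b i (hecke b j f) w)"
    unfolding 1 2 by (simp add: algebra_simps)
  finally show "?e * s (f w + x * hecke b j f w) = ?e * (f w + x * hecke b j f w)
      - (p - q) * hecke b i (\<lambda>w. f w + x * hecke b j f w) w"
    by (simp add: hecke_add hecke_cmult)
qed

text \<open>After factoring out the invariant \<open>f\<close>, what remains is (1 + b p)(1 + q u) =
  (1 + p u)(1 + b p - (p - q) u), a consequence of u^2 = b u.\<close>

lemma exch_last:
  assumes f: "\<And>w. distinct w \<Longrightarrow> length w = N \<Longrightarrow> s (f w) = f w"
    and pq: "s p = q" and i: "Suc i < N"
  shows "exch s b p q N i (\<lambda>w. f w + p * hecke b i f w)"
  unfolding exch_def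
proof (intro allI impI)
  fix w :: "nat list"
  assume w: "distinct w" "length w = N"
  have 1: "s (hecke b i f w) = hecke b i f w"
    unfolding hom_hecke using w i f by (intro hecke_cong[of w N]) auto
  have 2: "hecke b i (\<lambda>w. f w + p * hecke b i f w) w = (1 + b * p) * hecke b i f w"
    using w i by (simp add: hecke_add hecke_cmult hecke_quadratic algebra_simps)
  show "(1 + b * p) * s (f w + p * hecke b i f w) = (1 + b * p) * (f w + p * hecke b i f w)
      - (p - q) * hecke b i (\<lambda>w. f w + p * hecke b i f w) w"
    unfolding 2 using w f[of w] by (simp add: hom_add hom_mult pq 1 algebra_simps)
qed

text \<open>A Yang-Baxter equation: with u = u_i and v = u_(i+1), (1 + b p - (p - q) v)(1 + q u)(1 +
  p v) = (1 + p u)(1 + q v)(1 + b p - (p - q) u).\<close>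

lemma exch_step:
  assumes e: "exch s b p q N (Suc i) f"
    and pq: "s p = q" "s q = p" and i: "Suc (Suc i) < N"
  defines "g \<equiv> \<lambda>w. f w + p * hecke b i f w"
  shows "exch s b p q N i (\<lambda>w. g w + q * hecke b (Suc i) g w)"
  unfolding exch_def
proof (intro allI impI)
  fix w :: "nat list"
  assume w: "distinct w" "length w = N"
  let ?e = "1 + b * p" and ?R = "hecke b i" and ?S = "hecke b (Suc i)"
  let ?f' = "\<lambda>w. ?e * f w - (p - q) * ?S f w"
  let ?g' = "\<lambda>w. ?f' w + q * ?R ?f' w"
  have f': "?e * s (f w) = ?f' w" if "distinct w" "length w = N" for w
    using e that unfolding exch_def by blast
  have g': "?e * s (g w) = ?g' w" if "distinct w" "length w = N" for w
  proof -
    have "?e * s (g w) = ?e * s (f w) + q * ?R (\<lambda>w. ?e * s (f w)) w"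
      by (simp only: g_def hom_add hom_mult pq hom_hecke hecke_cmult) (simp add: algebra_simps)
    also have "?R (\<lambda>w. ?e * s (f w)) w = ?R ?f' w"
      using that i f' by (intro hecke_cong[of w N]) auto
    finally show ?thesis using f'[OF that] by simp
  qed
  have "?e * s (g w + q * ?S g w) = ?e * s (g w) + p * ?S (\<lambda>w. ?e * s (g w)) w"
    by (simp only: hom_add hom_mult pq hom_hecke hecke_cmult) (simp add: algebra_simps)
  also have "?S (\<lambda>w. ?e * s (g w)) w = ?S ?g' w"
    using w i g' by (intro hecke_cong[of w N]) auto
  also have "?e * s (g w) = ?g' w" using g' w by simp
  finally have L: "?e * s (g w + q * ?S g w) = ?g' w + p * ?S ?g' w" .
  have SS: "?S (?S f) w = b * ?S f w" and RR: "?R (?R f) w = b * ?R f w"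
    using w i by (auto intro: hecke_quadratic)
  have B: "?S (?R (?S f)) w = ?R (?S (?R f)) w"
    using w i by (simp add: hecke_braid)
  show "?e * s (g w + q * ?S g w) = ?e * (g w + q * ?S g w) - (p - q) * ?R (\<lambda>w. g w + q * ?S g w) w"
    unfolding L unfolding g_def
    by (simp only: hecke_add hecke_diff hecke_cmult SS RR B) (simp add: algebra_simps)
qed

text \<open>Induction through G = G' C. The relation for G' becomes one for u_(i+1) by the shift,
  passes the factors 0, ..., i-1 by \<open>exch_far\<close>, turns into one for u_i at the factors i
  and i+1 by \<open>exch_step\<close>, and passes the rest. If C ends with the factor i,
  \<open>exch_last\<close> applies.\<close>

lemma exch_gpoly:
  assumes "Suc i < n" and x: "s (x i) = x (Suc i)" "s (x (Suc i)) = x i"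
    "\<And>j. j \<noteq> i \<Longrightarrow> j \<noteq> Suc i \<Longrightarrow> s (x j) = x j"
  shows "exch s b (x i) (x (Suc i)) n i (gpoly b x n)"
  using assms(1)
proof (induction n)
  case (Suc n)
  let ?ex = "exch s b (x i) (x (Suc i)) (Suc n)"
  let ?F = "columns b x (lift_min (gpoly b x n))"
  have Suc_eq: "?F (Suc j) = (\<lambda>w. ?F j w + x j * hecke b j (?F j) w)" for j
    by (rule ext) simp
  have gpoly_eq: "gpoly b x (Suc n) = ?F n"
    by (rule ext) simp
  have up: "?ex i (?F k)" if "?ex i (?F m)" "Suc i < m" "m \<le> k" "k \<le> n" for m k
    using that(3,4)
  proof (induction k rule: dec_induct)
    case (step k)
    then show ?case unfolding Suc_eq
      using that(2) by (intro exch_far) (auto simp: x)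
  qed (use that in simp)
  show ?case
  proof (cases "Suc i < n")
    case True
    have "?ex (Suc i) (lift_min (gpoly b x n))"
      unfolding exch_def
    proof (intro allI impI)
      fix w :: "nat list" assume w: "distinct w" "length w = Suc n"
      then have "distinct (tl w)" "length (tl w) = n" by (auto simp: distinct_tl)
      then have "(1 + b * x i) * s (gpoly b x n (tl w))
        = (1 + b * x i) * gpoly b x n (tl w) - (x i - x (Suc i)) * hecke b i (gpoly b x n) (tl w)"
        using Suc.IH[OF True] unfolding exch_def by blast
      then show "(1 + b * x i) * s (lift_min (gpoly b x n) w)
        = (1 + b * x i) * lift_min (gpoly b x n) w
          - (x i - x (Suc i)) * hecke b (Suc i) (lift_min (gpoly b x n)) w"
        using w True by (simp add: hecke_lift_min lift_min_def hom_zero)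
    qed
    then have "?ex (Suc i) (?F 0)" by (simp add: exch_def hecke_def)
    moreover have "?ex (Suc i) (?F j)" if "?ex (Suc i) (?F 0)" "j \<le> i" for j
      using that(2)
    proof (induction j)
      case (Suc j)
      show ?case unfolding Suc_eq
        using Suc True by (intro exch_far) (auto simp: x)
    qed (use that in simp)
    ultimately have "?ex (Suc i) (?F i)" by blast
    from exch_step[OF this] have "?ex i (?F (Suc (Suc i)))"
      using True unfolding Suc_eq by (simp add: x)
    with True show ?thesis unfolding gpoly_eq by (intro up[of "Suc (Suc i)" n]) auto
  next
    case False
    then have n: "n = Suc i" using Suc.prems by simp
    have "gpoly b (\<lambda>j. s (x j)) n = gpoly b x n"
      by (rule gpoly_cong) (simp add: n x)
    then have "s (gpoly b x n w) = gpoly b x n w" for w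
      by (simp only: hom_gpoly sb)
    then have "s (lift_min (gpoly b x n) w) = lift_min (gpoly b x n) w" for w
      by (simp add: lift_min_def hom_zero)
    then have "s (?F i w) = columns b (\<lambda>j. s (x j)) (lift_min (gpoly b x n)) i w" for w
      using hom_columns[of "lift_min (gpoly b x n)" "lift_min (gpoly b x n)" b x i w] by (simp only: sb)
    moreover have "columns b (\<lambda>j. s (x j)) (lift_min (gpoly b x n)) i = ?F i"
      by (rule columns_cong) (simp add: x)
    ultimately have "s (?F i w) = ?F i w" for w by simp
    then have "?ex i (?F (Suc i))"
      unfolding Suc_eq by (intro exch_last) (auto simp: x n)
    then show ?thesis unfolding gpoly_eq by (simp only: n)
  qed
qed simp

end

subsection \<open>Grothendieck polynomials\<close>

lemma sum_single_lookup:
  fixes f :: "'a \<Rightarrow>\<^sub>0 'b::comm_monoid_add"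
  shows "(\<Sum>m\<in>Poly_Mapping.keys f. Poly_Mapping.single m (Poly_Mapping.lookup f m)) = f"
  by (rule poly_mapping_eqI)
    (simp add: Poly_Mapping.lookup_sum lookup_single when_def in_keys_iff sum.delta')

lemma keys_sum_add:
  fixes f g :: "'a \<Rightarrow>\<^sub>0 'b::comm_monoid_add" and \<phi> :: "'a \<Rightarrow> 'b \<Rightarrow> 'c::comm_monoid_add"
  assumes zero: "\<And>m. \<phi> m 0 = 0" and add: "\<And>m c d. \<phi> m (c + d) = \<phi> m c + \<phi> m d"
  shows "(\<Sum>m\<in>Poly_Mapping.keys (f + g). \<phi> m (Poly_Mapping.lookup (f + g) m))
    = (\<Sum>m\<in>Poly_Mapping.keys f. \<phi> m (Poly_Mapping.lookup f m))
      + (\<Sum>m\<in>Poly_Mapping.keys g. \<phi> m (Poly_Mapping.lookup g m))"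
proof -
  let ?K = "Poly_Mapping.keys f \<union> Poly_Mapping.keys g"
  have *: "(\<Sum>m\<in>Poly_Mapping.keys h. \<phi> m (Poly_Mapping.lookup h m)) = (\<Sum>m\<in>?K. \<phi> m (Poly_Mapping.lookup h m))"
    if "Poly_Mapping.keys h \<subseteq> ?K" for h
    using that by (intro sum.mono_neutral_left) (auto simp: in_keys_iff zero)
  show ?thesis
    unfolding *[OF Poly_Mapping.keys_add] *[OF Un_upper1] *[OF Un_upper2]
    by (simp add: lookup_add add sum.distrib)
qed

text \<open>Additivity reduces multiplicativity to products of monomials.\<close>

lemma comm_ring_hom_poly_mapping:
  fixes h :: "('a::comm_monoid_add \<Rightarrow>\<^sub>0 'b::comm_ring_1) \<Rightarrow> 'c::comm_ring_1"
  assumes add: "\<And>f g. h (f + g) = h f + h g" and one: "h 1 = 1"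
    and mult: "\<And>m c n d. h (Poly_Mapping.single (m + n) (c * d))
      = h (Poly_Mapping.single m c) * h (Poly_Mapping.single n d)"
  shows "comm_ring_hom h"
proof
  have zero: "h 0 = 0" using add[of 0 0] by simp
  have sum: "h (sum F A) = (\<Sum>a\<in>A. h (F a))" for F :: "'d \<Rightarrow> 'a \<Rightarrow>\<^sub>0 'b" and A
    by (induction A rule: infinite_finite_induct) (simp_all add: zero add)
  fix f g :: "'a \<Rightarrow>\<^sub>0 'b"
  let ?s = "\<lambda>f m. Poly_Mapping.single m (Poly_Mapping.lookup f m) :: 'a \<Rightarrow>\<^sub>0 'b"
  have "h (f * g) = h ((\<Sum>m\<in>Poly_Mapping.keys f. ?s f m) * (\<Sum>n\<in>Poly_Mapping.keys g. ?s g n))"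
    by (simp only: sum_single_lookup)
  also have "\<dots> = (\<Sum>m\<in>Poly_Mapping.keys f. \<Sum>n\<in>Poly_Mapping.keys g. h (?s f m) * h (?s g n))"
    by (simp add: sum_product sum mult_single mult)
  also have "\<dots> = h (\<Sum>m\<in>Poly_Mapping.keys f. ?s f m) * h (\<Sum>n\<in>Poly_Mapping.keys g. ?s g n)"
    by (simp only: sum_product sum)
  finally show "h (f * g) = h f * h g"
    by (simp only: sum_single_lookup)
qed (fact add one)+

lemma swap_idx_swap_idx [simp]: "swap_idx i (swap_idx i j) = j"
  by (simp add: swap_idx_def)

lemma inj_swap_idx: "inj (swap_idx i)"
  by (metis injI swap_idx_swap_idx)

lemma swap_vars_single:
  "swap_vars i (Poly_Mapping.single m c) = Poly_Mapping.single (Poly_Mapping.map_key (swap_idx i) m) c"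
  by (simp add: swap_vars_def)

lemma comm_ring_hom_swap_vars: "comm_ring_hom (swap_vars i)"
proof (rule comm_ring_hom_poly_mapping)
  show "swap_vars i (f + g) = swap_vars i f + swap_vars i g" for f g
    unfolding swap_vars_def by (rule keys_sum_add) (simp_all add: single_add)
  have "Poly_Mapping.map_key (swap_idx i) (0 :: nat \<Rightarrow>\<^sub>0 nat) = 0" by (rule map_key_zero[OF inj_swap_idx])
  then show "swap_vars i 1 = 1"
    unfolding single_one[symmetric] swap_vars_single by simp
qed (simp add: swap_vars_single mult_single map_key_plus[OF inj_swap_idx])

lemma comm_ring_hom_eval_ones: "comm_ring_hom eval_ones"
proof (rule comm_ring_hom_poly_mapping)
  show "eval_ones (f + g) = eval_ones f + eval_ones g" for f g
    unfolding eval_ones_def by (rule keys_sum_add) simp_all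
qed (simp_all add: eval_ones_def)

lemma swap_vars_Xv: "swap_vars i (Xv j) = Xv (swap_idx i j)"
proof -
  have "Poly_Mapping.map_key (swap_idx i) (Poly_Mapping.single (swap_idx i (swap_idx i j)) 1)
    = Poly_Mapping.single (swap_idx i j) (1::nat)"
    by (rule map_key_single[OF inj_swap_idx])
  then show ?thesis by (simp add: Xv_def swap_vars_single)
qed

lemma swap_vars_betaC: "swap_vars i betaC = betaC"
  by (simp add: betaC_def swap_vars_single map_key_zero[OF inj_swap_idx])

lemma Xv_neq: "Xv i \<noteq> Xv (Suc i)"
proof
  assume "Xv i = Xv (Suc i)"
  then have "Poly_Mapping.keys (Xv i) = Poly_Mapping.keys (Xv (Suc i))" by simp
  then have "Poly_Mapping.single i (1::nat) = Poly_Mapping.single (Suc i) 1"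
    by (simp add: Xv_def)
  then have "Poly_Mapping.keys (Poly_Mapping.single i (1::nat)) = Poly_Mapping.keys (Poly_Mapping.single (Suc i) (1::nat))"
    by simp
  then show False by simp
qed

text \<open>Polynomials form an integral domain and x_i - x_(i+1) is nonzero, so there is at most
  one quotient for \<open>THE\<close> to pick.\<close>

lemma divdiff_eqI:
  assumes "(Xv i - Xv (Suc i)) * g = f - swap_vars i f"
  shows "divdiff i f = g"
  unfolding divdiff_def
proof (rule the_equality)
  fix g' assume "(Xv i - Xv (Suc i)) * g' = f - swap_vars i f"
  then have "(Xv i - Xv (Suc i)) * g' = (Xv i - Xv (Suc i)) * g" using assms by simp
  then show "g' = g" using Xv_neq[of i] by (simp add: mult_left_cancel)
qed (fact assms)

text \<open>The exchange relation, read at \<open>swap_pos w i\<close>: this word has a descent at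
  \<open>i\<close>, so its \<open>hecke\<close> term brings in the value at
  \<open>w\<close>.\<close>

lemma pi_op_gpoly:
  assumes "distinct w" "length w = n" "Suc i < n" "w ! i < w ! Suc i"
  shows "pi_op i (gpoly betaC Xv n (swap_pos w i)) = gpoly betaC Xv n w"
  unfolding pi_op_def
proof (rule divdiff_eqI)
  interpret comm_ring_hom "swap_vars i" by (rule comm_ring_hom_swap_vars)
  let ?v = "swap_pos w i" and ?p = "Xv i" and ?q = "Xv (Suc i)" and ?G = "gpoly betaC Xv n"
  have "exch (swap_vars i) betaC ?p ?q n i ?G"
    using assms(3) by (intro exch_gpoly comm_ring_hom_swap_vars swap_vars_betaC)
      (auto simp: swap_vars_Xv swap_idx_def)
  moreover have "distinct ?v" "length ?v = n" using assms by simp_all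
  ultimately have 1: "(1 + betaC * ?p) * swap_vars i (?G ?v)
      = (1 + betaC * ?p) * ?G ?v - (?p - ?q) * hecke betaC i ?G ?v"
    unfolding exch_def by blast
  have 2: "hecke betaC i ?G ?v = ?G w + betaC * ?G ?v"
    using assms by (simp add: hecke_def nth_swap_pos)
  have "swap_vars i ((1 + betaC * ?q) * ?G ?v) = (1 + betaC * ?p) * swap_vars i (?G ?v)"
    by (simp add: hom_mult hom_add hom_one swap_vars_betaC swap_vars_Xv swap_idx_def)
  then show "(?p - ?q) * ?G w = (1 + betaC * ?q) * ?G ?v - swap_vars i ((1 + betaC * ?q) * ?G ?v)"
    unfolding 1 2 by (simp add: algebra_simps)
qed

section \<open>Identification with the fuelled recursion\<close>

primrec noninv :: "nat list \<Rightarrow> nat" where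
  "noninv [] = 0"
| "noninv (a # w) = length (filter (\<lambda>b. a < b) w) + noninv w"

lemma noninv_le: "noninv w \<le> length w ^ 2"
proof (induction w)
  case (Cons a w)
  have "length (filter (\<lambda>b. a < b) w) \<le> length w" by simp
  then have "length (filter (\<lambda>b. a < b) w) + noninv w \<le> length w + length w * length w"
    using Cons by (intro add_mono) (simp_all add: power2_eq_square)
  then show ?case by (simp add: power2_eq_square)
qed simp

lemma noninv_swap: "a < b \<Longrightarrow> noninv (p @ a # b # q) = Suc (noninv (p @ b # a # q))"
  by (induction p) auto

lemma split_adjacent:
  assumes "Suc i < length w"
  obtains p q where "w = p @ w ! i # w ! Suc i # q" "length p = i"
proof
  show "w = take i w @ w ! i # w ! Suc i # drop (Suc (Suc i)) w"
    using assms by (simp add: Cons_nth_drop_Suc id_take_nth_drop[symmetric])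
qed (use assms in simp)

text \<open>Reading \<open>columns\<close> backwards, a least letter at position \<open>j\<close> is forced to move to the front, and
  one further to the right never gets there.\<close>

lemma columns_min:
  assumes "\<forall>y\<in>set p \<union> set q. a < y" and "j \<le> length p"
  shows "columns b x (lift_min g) j (p @ a # q) = (if length p = j then (\<Prod>i<j. x i) * g (p @ q) else 0)"
  using assms
proof (induction j arbitrary: p q)
  case 0
  then show ?case by (cases p) (auto simp: lift_min_def)
next
  case (Suc j)
  obtain c p' where p: "p = p' @ [c]" 
    using Suc.prems(2) by (cases p rule: rev_cases) auto
  have len: "j \<le> length p'" using Suc.prems(2) p by auto
  have mono: "columns b x (lift_min g) j (p @ a # q) = 0"
    using Suc.IH[of p q] Suc.prems(1) len by (auto simp: p)
  show ?case
  proof (cases "length p' = j")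
    case True
    then have "(p @ a # q) ! j = c" "(p @ a # q) ! Suc j = a" "swap_pos (p @ a # q) j = p' @ a # c # q"
      using swap_pos_append[of p' c a q] by (simp_all add: p nth_append)
    then show ?thesis
      using Suc.IH[of p' "c # q"] Suc.prems(1) mono True by (auto simp: p hecke_def)
  next
    case False
    then have "Suc j < length p" using len p by simp
    then obtain r s t u where "p = r @ t # u # s" "length r = j"
      by (metis split_adjacent)
    then have "swap_pos (p @ a # q) j = (r @ u # t # s) @ a # q" 
      using swap_pos_append[of r t u "s @ a # q"] by simp
    then have "columns b x (lift_min g) j (swap_pos (p @ a # q) j) = 0"
      using Suc.IH[of "r @ u # t # s" q] Suc.prems(1) \<open>p = r @ t # u # s\<close> \<open>length r = j\<close> by auto
    with mono \<open>Suc j < length p\<close> show ?thesis by (simp add: hecke_def)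
  qed
qed

lemma gpoly_decreasing:
  "sorted_wrt (>) w \<Longrightarrow> gpoly betaC Xv (length w) w = groth_top (length w)"
proof (induction w rule: rev_induct)
  case (snoc a w)
  have "groth_top (Suc n) = (\<Prod>j<n. Xv j) * groth_top n" for n
  proof -
    \<comment> \<open>The factor \<open>j = n\<close> has exponent 0 and drops out.\<close>
    have "groth_top (Suc n) = (\<Prod>j<n. Xv j ^ (n - j))"
      by (simp add: groth_top_def)
    also have "\<dots> = (\<Prod>j<n. Xv j * Xv j ^ (n - 1 - j))"
      by (rule prod.cong) (auto simp flip: power_Suc simp: Suc_diff_Suc)
    finally show ?thesis by (simp add: groth_top_def prod.distrib)
  qed
  with snoc show ?case by (simp add: sorted_wrt_append columns_min)
qed (simp add: groth_top_def)

lemma sorted_wrt_if_no_ascent: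
  assumes "distinct w" "\<not> has_ascent w"
  shows "sorted_wrt (>) w"
proof -
  have "w ! Suc i < w ! i" if "Suc i < length w" for i
    using assms that nth_eq_iff_index_eq[of w i "Suc i"] by (force simp: has_ascent_def)
  then show ?thesis
    by (simp add: sorted_wrt_iff_nth_Suc_transp transp_def)
qed

text \<open>Each swap of an ascent lowers \<open>noninv\<close> by one, so the fuel lasts until the
  word is decreasing. As \<open>pi_op_gpoly\<close> holds at every ascent, the choice of the first
  one is immaterial.\<close>

lemma groth_aux_eq_gpoly:
  "\<lbrakk>distinct w; length w = n; noninv w \<le> k\<rbrakk> \<Longrightarrow> groth_aux n k w = gpoly betaC Xv n w"
proof (induction k arbitrary: w)
  case 0
  have "\<not> has_ascent w"
  proof
    assume "has_ascent w"
    then obtain i where i: "Suc i < length w" "w ! i < w ! Suc i" by (auto simp: has_ascent_def)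
    obtain p q where "w = p @ w ! i # w ! Suc i # q" using i(1) by (rule split_adjacent)
    with noninv_swap[OF i(2), of p q] 0 show False by simp
  qed
  with 0 show ?case using gpoly_decreasing sorted_wrt_if_no_ascent by auto
next
  case (Suc k)
  show ?case
  proof (cases "has_ascent w")
    case True
    define i where "i = first_ascent w"
    have i: "Suc i < length w" "w ! i < w ! Suc i"
      using True LeastI_ex[of "\<lambda>i. Suc i < length w \<and> w ! i < w ! Suc i"]
      unfolding has_ascent_def i_def first_ascent_def by blast+
    obtain p q where w: "w = p @ w ! i # w ! Suc i # q" "length p = i"
      using i(1) by (rule split_adjacent)
    have "swap_pos w i = p @ w ! Suc i # w ! i # q"
      using swap_pos_append[of p "w ! i" "w ! Suc i" q] w by simp
    then have "Suc (noninv (swap_pos w i)) = noninv w"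
      using noninv_swap[OF i(2), of p q] w by simp
    then have "groth_aux n k (swap_pos w i) = gpoly betaC Xv n (swap_pos w i)"
      using Suc i by (intro Suc.IH) auto
    then show ?thesis
      using True Suc.prems i by (simp add: pi_op_gpoly flip: i_def)
  next
    case False
    then show ?thesis
      using Suc.prems gpoly_decreasing sorted_wrt_if_no_ascent by auto
  qed
qed

text \<open>The principal specialization on words with arbitrary letters, so that subwords need not
  be standardized.\<close>

definition ups :: "nat list \<Rightarrow> int poly" where
  "ups w = gpoly [:0, 1:] (\<lambda>_. 1) (length w) w"

lemma Upsilon_eq_ups:
  assumes "distinct w"
  shows "Upsilon w = ups w"
proof -
  have "grothendieck w = gpoly betaC Xv (length w) w"
    unfolding grothendieck_def using assms noninv_le by (intro groth_aux_eq_gpoly) auto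
  moreover have "eval_ones betaC = [:0, 1:]" "eval_ones (Xv j) = 1" for j
    by (simp_all add: betaC_def Xv_def eval_ones_def)
  ultimately show ?thesis
    by (simp add: Upsilon_def ups_def comm_ring_hom.hom_gpoly[OF comm_ring_hom_eval_ones])
qed

section \<open>Invariance under order-preserving relabelling\<close>

lemma gpoly_map:
  assumes "strict_mono_on (set w) \<sigma>" "length w = n"
  shows "gpoly b x n (map \<sigma> w) = gpoly b x n w"
  using assms
proof (induction n arbitrary: w)
  case (Suc n)
  have less: "\<sigma> y < \<sigma> z \<longleftrightarrow> y < z" if "y \<in> set w" "z \<in> set w" for y z
    using Suc.prems(1) that by (simp add: strict_mono_on_less)
  \<comment> \<open>Generalized from \<open>w\<close> to every \<open>v\<close> on the same letters,
    because the swaps in \<open>columns\<close> rearrange the word.\<close>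
  have "columns b x (lift_min (gpoly b x n)) j (map \<sigma> v) = columns b x (lift_min (gpoly b x n)) j v"
    if "set v = set w" "length v = Suc n" "j \<le> n" for j v
    using that
  proof (induction j arbitrary: v)
    case 0
    then obtain c u where v: "v = c # u" by (cases v) auto
    have "strict_mono_on (set u) \<sigma>"
      using Suc.prems(1) 0 v by (auto intro: monotone_on_subset)
    then have "gpoly b x n (map \<sigma> u) = gpoly b x n u" using Suc.IH 0 v by simp
    then show ?case using less 0 v by (auto simp: lift_min_def)
  next
    case (Suc j)
    have "swap_pos (map \<sigma> v) j = map \<sigma> (swap_pos v j)"
      using Suc.prems by (simp add: swap_pos_def map_update)
    moreover have "\<sigma> (v ! Suc j) < \<sigma> (v ! j) \<longleftrightarrow> v ! Suc j < v ! j"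
      using Suc.prems by (intro less) (auto simp flip: Suc.prems(1))
    ultimately show ?case
      using Suc.prems by (simp add: hecke_def Suc.IH)
  qed
  then show ?case using Suc.prems by simp
qed simp

lemma strict_mono_on_std: "strict_mono_on (set (v :: nat list)) (\<lambda>x. card {y \<in> set v. y \<le> x})"
proof (rule strict_mono_onI)
  fix x z :: nat assume "x \<in> set v" "z \<in> set v" "x < z"
  then have "{y \<in> set v. y \<le> x} \<subseteq> {y \<in> set v. y \<le> z}"
    "z \<in> {y \<in> set v. y \<le> z}" "z \<notin> {y \<in> set v. y \<le> x}" by auto
  then show "card {y \<in> set v. y \<le> x} < card {y \<in> set v. y \<le> z}"
    by (intro psubset_card_mono) auto
qed

lemma Upsilon_std:
  assumes "distinct v"
  shows "Upsilon (std v) = ups v"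
proof -
  have "inj_on (\<lambda>x. card {y \<in> set v. y \<le> x}) (set v)"
    by (rule strict_mono_on_imp_inj_on[OF strict_mono_on_std])
  then have "distinct (std v)" using assms by (simp add: std_def distinct_map)
  then have "Upsilon (std v) = ups (std v)" by (rule Upsilon_eq_ups)
  also have "\<dots> = ups v"
    by (simp add: ups_def std_def gpoly_map[OF strict_mono_on_std])
  finally show ?thesis .
qed

subsection \<open>Splitting off the least letter\<close>

text \<open>The letters right of the least one are read from right to left: in \<open>bubble p m l v\<close> the list \<open>l\<close>
  is the reversal of the part not yet read, \<open>m\<close> is the letter being carried to the left, and \<open>v\<close> is
  the output.  The summand \<open>moved\<close> collects the terms in which \<open>m\<close> crosses a letter or picks up a
  factor \<open>[:0, 1:]\<close>, that is \<open>\<beta>\<close>.\<close>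

primrec bubble :: "nat list \<Rightarrow> nat \<Rightarrow> nat list \<Rightarrow> nat list \<Rightarrow> int poly" where
  "bubble p m [] v = ups (p @ m # v)"
| "bubble p m (z # l) v = bubble p z l (m # v) +
     (if m < z then [:0, 1:] * bubble p z l (m # v) + bubble p m l (z # v) else 0)"

text \<open>The state in which no letter is carried: the next unread letter, if any, is picked
  up.\<close>

primrec idle :: "nat list \<Rightarrow> nat list \<Rightarrow> nat list \<Rightarrow> int poly" where
  "idle p [] v = ups (p @ v)"
| "idle p (z # l) v = bubble p z l v"

definition moved :: "nat list \<Rightarrow> nat \<Rightarrow> nat list \<Rightarrow> nat list \<Rightarrow> int poly" where
  "moved p m l v = bubble p m l v - idle p l (m # v)"

text \<open>This and the next three are equations between functions of \<open>v\<close>, for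
  rewriting under \<open>ssum\<close>.\<close>

lemma idle_Nil_fun: "idle p [] = (\<lambda>v. ups (p @ v))"
  by (rule ext) simp

lemma idle_Cons_fun: "idle p (z # l) = (\<lambda>v. idle p l (z # v) + moved p z l v)"
  by (rule ext) (simp add: moved_def)

lemma moved_Nil_fun: "moved p m [] = (\<lambda>v. 0)"
  by (rule ext) (simp add: moved_def)

lemma moved_Cons_fun:
  "moved p m (z # l) = (if m < z then (\<lambda>v. [:0, 1:] * idle p (z # l) (m # v) +
     (idle p l (m # z # v) + moved p m l (z # v))) else (\<lambda>v. 0))"
  by (rule ext) (simp add: moved_def)

text \<open>The outermost factor compares the carried \<open>m\<close> with its left neighbour
  \<open>z\<close>: the summand 1 puts \<open>m\<close> down and picks up \<open>z\<close>, while at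
  a descent \<open>hecke\<close> lets \<open>m\<close> cross or contributes \<beta>.\<close>

lemma columns_eq_bubble:
  assumes "\<forall>y\<in>set p \<union> set l \<union> insert m (set v). a < y"
    and "N = length p + length l + Suc (length v)"
  shows "columns [:0, 1:] (\<lambda>_. 1) (lift_min (gpoly [:0, 1:] (\<lambda>_. 1) N))
      (Suc (length p + length l)) (p @ a # rev l @ m # v) = bubble p m l v"
  using assms
proof (induction l arbitrary: m v)
  case Nil
  \<comment> \<open>The carried letter has reached \<open>a\<close>: this ascent makes
    \<open>hecke\<close> vanish, and \<open>columns_min\<close> then removes
    \<open>a\<close>.\<close>
  have "(p @ a # m # v) ! Suc (length p) = m" "(p @ a # m # v) ! length p = a"
    by (simp_all add: nth_append)
  with Nil show ?case by (simp add: hecke_def columns_min ups_def del: gpoly.simps)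
next
  case (Cons z l)
  let ?F = "columns [:0, 1:] (\<lambda>_. 1) (lift_min (gpoly [:0, 1:] (\<lambda>_. 1) N))"
  let ?k = "Suc (length p + length l)" and ?w = "p @ a # rev (z # l) @ m # v"
  have "?F ?k (p @ a # rev l @ z # m # v) = bubble p z l (m # v)"
    by (rule Cons.IH) (use Cons.prems in auto)
  then have 1: "?F ?k ?w = bubble p z l (m # v)" by simp
  have "?F ?k (p @ a # rev l @ m # z # v) = bubble p m l (z # v)"
    by (rule Cons.IH) (use Cons.prems in auto)
  moreover have "swap_pos ?w ?k = p @ a # rev l @ m # z # v"
    using swap_pos_append[of "p @ a # rev l" z m v] by simp
  ultimately have 2: "?F ?k (swap_pos ?w ?k) = bubble p m l (z # v)" by simp
  have 3: "?w ! ?k = z" "?w ! Suc ?k = m"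
    by (simp_all add: nth_append nth_Cons')
  have "?F (Suc ?k) ?w = ?F ?k ?w +
      (if ?w ! Suc ?k < ?w ! ?k then ?F ?k (swap_pos ?w ?k) + [:0, 1:] * ?F ?k ?w else 0)"
    by (simp only: columns.simps mult_1 hecke_def)
  also have "\<dots> = bubble p m (z # l) v"
    by (simp only: 1 2 3 bubble.simps) (simp only: add.commute)
  finally show ?case by simp
qed

lemma ups_split_min:
  assumes "\<forall>y\<in>set p \<union> set q. a < y"
  shows "ups (p @ a # q) = idle p (rev q) []"
proof (cases q rule: rev_cases)
  case Nil
  then show ?thesis using assms by (simp add: ups_def columns_min)
next
  case (snoc l m)
  then show ?thesis using columns_eq_bubble[of p "rev l" m "[]" a] assms by (simp add: ups_def del: columns.simps)
qed

subsection \<open>Signed sums over subwords\<close>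

text \<open>A letter paired with \<open>True\<close> has to be present in the subword.\<close>

type_synonym mword = "(nat \<times> bool) list"

fun ssum :: "(nat list \<Rightarrow> 'a::comm_ring_1) \<Rightarrow> mword \<Rightarrow> 'a" where
  "ssum f [] = f []"
| "ssum f ((z, k) # ws) = ssum (\<lambda>v. f (z # v)) ws - (if k then 0 else ssum f ws)"


lemma ssum_add: "ssum (\<lambda>v. f v + g v) ws = ssum f ws + ssum g ws"
proof (induction ws arbitrary: f g)
  case (Cons c ws)
  then show ?case by (cases c) simp
qed simp

lemma ssum_cmult: "ssum (\<lambda>v. c * f v) ws = c * ssum f ws"
proof (induction ws arbitrary: f)
  case (Cons c ws)
  then show ?case by (cases c) (simp add: right_diff_distrib)
qed simp

lemma ssum_diff: "ssum (\<lambda>v. f v - g v) ws = ssum f ws - ssum g ws"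
  using ssum_add[of f "\<lambda>v. - 1 * g v" ws] ssum_cmult[of "- 1" g ws] by simp

lemma ssum_minus: "ssum (\<lambda>v. - f v) ws = - ssum f ws"
  using ssum_cmult[of "- 1" f ws] by simp

lemma ssum_0: "ssum (\<lambda>v. 0) ws = 0"
  using ssum_cmult[of 0 "\<lambda>_. 0" ws] by simp

lemma ssum_cong:
  assumes "\<And>v. set v \<subseteq> fst ` set ws \<Longrightarrow> f v = g v"
  shows "ssum f ws = ssum g ws"
  using assms
proof (induction ws arbitrary: f g)
  case (Cons c ws)
  obtain z k where c: "c = (z, k)" by fastforce
  have "ssum (\<lambda>v. f (z # v)) ws = ssum (\<lambda>v. g (z # v)) ws"
    by (rule Cons.IH, rule Cons.prems) (auto simp: c)
  moreover have "ssum f ws = ssum g ws"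
    by (rule Cons.IH, rule Cons.prems) (auto simp: c)
  ultimately show ?case by (simp add: c)
qed simp

lemma ssum_append: "ssum f (us @ ws) = ssum (\<lambda>u. ssum (\<lambda>v. f (u @ v)) ws) us"
proof (induction us arbitrary: f)
  case (Cons c us)
  then show ?case by (cases c) simp
qed simp

lemma ssum_rev: "ssum f (rev ws) = ssum (\<lambda>v. f (rev v)) ws"
proof (induction ws arbitrary: f)
  case (Cons c ws)
  then show ?case by (cases c) (simp add: ssum_append ssum_diff ssum_0)
qed simp

definition idle_sum :: "mword \<Rightarrow> mword \<Rightarrow> mword \<Rightarrow> int poly" where
  "idle_sum P ls V = ssum (\<lambda>p. ssum (\<lambda>l. ssum (idle p l) V) ls) P"

text \<open>The carried letter \<open>m\<close> is not summed over, so it counts as present.\<close>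

definition moved_sum :: "mword \<Rightarrow> nat \<Rightarrow> mword \<Rightarrow> mword \<Rightarrow> int poly" where
  "moved_sum P m ls V = ssum (\<lambda>p. ssum (\<lambda>l. ssum (moved p m l) V) ls) P"

lemma idle_sum_Nil: "idle_sum P [] V = ssum ups (P @ V)"
  by (simp add: idle_sum_def idle_Nil_fun ssum_append)

text \<open>Putting \<open>z\<close> down unmoved is compatible with its absence, so
  \<open>z\<close> enters \<open>V\<close> with its own mark; a moving \<open>z\<close> is
  present.\<close>

lemma idle_sum_Cons: "idle_sum P ((z, k) # ls) V = idle_sum P ls ((z, k) # V) + moved_sum P z ls V"
  by (cases k) (simp_all add: idle_sum_def moved_sum_def idle_Cons_fun ssum_add ssum_diff)

lemma moved_sum_Nil: "moved_sum P m [] V = 0"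
  by (simp add: moved_sum_def moved_Nil_fun ssum_0)

text \<open>A present \<open>z\<close> blocks \<open>m\<close>, so only the subwords without
  \<open>z\<close> contribute. This is the negative term that the marking has to kill.\<close>

lemma moved_sum_Cons_le:
  "z \<le> m \<Longrightarrow> moved_sum P m ((z, k) # ls) V = (if k then 0 else - moved_sum P m ls V)"
  by (cases k) (simp_all add: moved_sum_def moved_Cons_fun ssum_minus ssum_0)

text \<open>In the first two terms \<open>m\<close> stops next to \<open>z\<close>, which must be
  present. Only the last term, where \<open>m\<close> moves on beyond \<open>z\<close>, absorbs the
  subwords without \<open>z\<close>; there \<open>z\<close> keeps its mark.\<close>

lemma moved_sum_Cons_less:
  "m < z \<Longrightarrow> moved_sum P m ((z, k) # ls) V =
     [:0, 1:] * idle_sum P ((z, True) # ls) ((m, True) # V)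
     + (idle_sum P ls ((m, True) # (z, True) # V) + moved_sum P m ls ((z, k) # V))"
  by (cases k)
    (simp_all only: moved_sum_def idle_sum_def moved_Cons_fun ssum.simps if_True if_False diff_0_right
      ssum_add ssum_diff ssum_cmult algebra_simps)

lemma moved_sum_eq_0:
  "\<forall>z\<in>fst ` set ls. z \<le> m \<Longrightarrow> moved_sum P m ls V = 0"
proof (induction ls)
  case (Cons c ls)
  then show ?case by (cases c) (simp add: moved_sum_Cons_le)
qed (simp add: moved_sum_Nil)

lemma ssum_ups_split_min:
  assumes "\<forall>y\<in>fst ` (set P \<union> set Q). a < y"
  shows "ssum ups (P @ (a, k) # Q) = idle_sum P (rev Q) [] - (if k then 0 else ssum ups (P @ Q))"
proof -
  have "ssum (\<lambda>q. ups (p @ a # q)) Q = ssum (\<lambda>q. idle p (rev q) []) Q"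
    if "set p \<subseteq> fst ` set P" for p
    using assms that by (intro ssum_cong ups_split_min) auto
  then have "ssum (\<lambda>p. ssum (\<lambda>q. ups (p @ a # q)) Q) P = ssum (\<lambda>p. ssum (\<lambda>q. idle p (rev q) []) Q) P"
    by (rule ssum_cong)
  also have "\<dots> = idle_sum P (rev Q) []"
    by (simp add: idle_sum_def ssum_rev)
  finally show ?thesis by (simp add: ssum_append ssum_diff ssum_0)
qed

subsection \<open>Marked occurrences of 1423\<close>

text \<open>In every occurrence of 1423 the letter in the role of 2 is marked; \<open>lo\<close> and \<open>y\<close> play the
  roles of 1 and 4.  The non-strict comparisons make no difference on words with distinct letters.\<close>

primrec marked_23 :: "nat \<Rightarrow> nat \<Rightarrow> mword \<Rightarrow> bool" where
  "marked_23 lo y [] = True"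
| "marked_23 lo y (c # ws) =
     ((snd c \<or> (\<forall>d\<in>set ws. \<not> (lo \<le> fst c \<and> fst c \<le> fst d \<and> fst d < y))) \<and> marked_23 lo y ws)"

primrec marked_423 :: "nat \<Rightarrow> mword \<Rightarrow> bool" where
  "marked_423 lo [] = True"
| "marked_423 lo (c # ws) = (marked_23 lo (fst c) ws \<and> marked_423 lo ws)"

primrec marked_1423 :: "mword \<Rightarrow> bool" where
  "marked_1423 [] = True"
| "marked_1423 (c # ws) = (marked_423 (fst c) ws \<and> marked_1423 ws)"

lemma marked_23_mono: "marked_23 lo y ws \<Longrightarrow> lo \<le> lo' \<Longrightarrow> marked_23 lo' y ws"
  by (induction ws) auto

lemma marked_23_mark: "marked_23 lo y (A @ (z, k) # B) \<Longrightarrow> marked_23 lo y (A @ (z, True) # B)"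
  by (induction A) auto

lemma marked_423_mark: "marked_423 lo (A @ (z, k) # B) \<Longrightarrow> marked_423 lo (A @ (z, True) # B)"
  by (induction A) (auto dest: marked_23_mark)

lemma marked_1423_mark: "marked_1423 (A @ (z, k) # B) \<Longrightarrow> marked_1423 (A @ (z, True) # B)"
  by (induction A) (auto dest: marked_423_mark)

lemma marked_23_delete: "marked_23 lo y (A @ c # B) \<Longrightarrow> marked_23 lo y (A @ B)"
  by (induction A) auto

lemma marked_423_delete: "marked_423 lo (A @ c # B) \<Longrightarrow> marked_423 lo (A @ B)"
  by (induction A) (auto dest: marked_23_delete)

lemma marked_1423_delete: "marked_1423 (A @ c # B) \<Longrightarrow> marked_1423 (A @ B)"
  by (induction A) (auto dest: marked_423_delete)

lemma marked_423_append: "marked_423 lo (A @ B) \<Longrightarrow> marked_423 lo B"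
  by (induction A) auto

lemma marked_1423_append: "marked_1423 (A @ B) \<Longrightarrow> marked_1423 B"
  by (induction A) auto

lemma marked_23_swap: "m < z \<Longrightarrow> marked_23 lo y (A @ (z, k) # (m, True) # B) \<Longrightarrow> marked_23 lo y (A @ (m, True) # (z, k) # B)"
  by (induction A) auto

lemma marked_423_swap: "m < z \<Longrightarrow> marked_423 lo (A @ (z, k) # (m, True) # B) \<Longrightarrow> marked_423 lo (A @ (m, True) # (z, k) # B)"
  by (induction A) (auto dest: marked_23_swap)

text \<open>New occurrences of 1423 either have \<open>m\<close> as the 2 and \<open>z\<close> as
  the 3, and \<open>m\<close> is marked, or have \<open>m\<close> and \<open>z\<close> as 1 and 4;
  then \<open>lo\<close> could already serve as the 1, and \<open>marked_23 lo z B\<close> marks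
  their 2.\<close>

lemma marked_1423_swap:
  assumes "m < z" "lo \<le> m" "marked_23 lo z B" "marked_1423 (A @ (z, k) # (m, True) # B)"
  shows "marked_1423 (A @ (m, True) # (z, k) # B)"
  using assms(4)
proof (induction A)
  case Nil
  then show ?case using assms(1) marked_23_mono[OF assms(3,2)] by auto
next
  case (Cons c A)
  then show ?case using marked_423_swap[OF assms(1)] by auto
qed

text \<open>A larger letter in \<open>A\<close> would be the 4 of an occurrence with 3 =
  \<open>m\<close> whose 2, namely \<open>z\<close>, is unmarked.\<close>

lemma marked_423_below:
  assumes "marked_423 lo (A @ (z, False) # B)" "(m, k) \<in> set B" "lo \<le> z" "z \<le> m"
  shows "\<forall>y\<in>fst ` set A. y \<le> m"
proof -
  have "\<not> marked_23 lo y (C @ (z, False) # B)" if "m < y" for y C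
  proof -
    have "\<exists>d\<in>set B. lo \<le> z \<and> z \<le> fst d \<and> fst d < y"
      using assms(2-4) that by (intro bexI[of _ "(m, k)"]) auto
    then show ?thesis by (induction C) auto
  qed
  with assms(1) show ?thesis
    by (induction A) (auto simp flip: not_less)
qed

section \<open>Nonnegativity by induction on the number of letters\<close>

definition nonneg :: "int poly \<Rightarrow> bool" where
  "nonneg f \<longleftrightarrow> (\<forall>k. 0 \<le> coeff f k)"

lemma nonneg_0 [simp]: "nonneg 0" by (simp add: nonneg_def)

lemma nonneg_add: "nonneg f \<Longrightarrow> nonneg g \<Longrightarrow> nonneg (f + g)"
  by (simp add: nonneg_def)

lemma nonneg_diffD: "nonneg (f - g) \<Longrightarrow> nonneg g \<Longrightarrow> nonneg f"
  using nonneg_add[of "f - g" g] by simp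

lemma nonneg_beta: "nonneg f \<Longrightarrow> nonneg ([:0, 1:] * f)"
  by (simp add: nonneg_def coeff_pCons split: nat.split)

text \<open>Both claims are proved together along the unread letters. Here \<open>lo\<close> is the
  deleted least letter, which stood between \<open>P\<close> and the rest, hence
  \<open>marked_423 lo R\<close>; the subtracted sum is the term in which nothing moves.\<close>

lemma idle_moved_nonneg:
  fixes P :: mword and lo :: nat and n :: nat
  assumes IH: "\<And>ws. length ws = n \<Longrightarrow> distinct (map fst ws) \<Longrightarrow> marked_1423 ws \<Longrightarrow> nonneg (ssum ups ws)"
  defines "good \<equiv> \<lambda>R. marked_1423 (P @ R) \<and> marked_423 lo R \<and> distinct (map fst (P @ R)) \<and>
    length (P @ R) = n \<and> (\<forall>y\<in>fst ` set R. lo \<le> y)"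
  shows "(\<forall>V. good (rev ls @ V) \<longrightarrow> nonneg (idle_sum P ls V - ssum ups (P @ rev ls @ V))) \<and>
    (\<forall>m V. good (rev ls @ (m, True) # V) \<longrightarrow> nonneg (moved_sum P m ls V))"
proof (induction ls)
  case Nil
  then show ?case by (simp add: idle_sum_Nil moved_sum_Nil)
next
  case (Cons c ls)
  obtain z k where c: "c = (z, k)" by fastforce
  have good_mark: "good (A @ (x, True) # B)" if "good (A @ (x, j) # B)" for A B x j
    using that marked_1423_mark[of "P @ A" x j B] unfolding good_def by (auto dest: marked_423_mark)
  have ups: "nonneg (ssum ups (P @ R))" if "good R" for R
    using that unfolding good_def by (intro IH) blast+
  have idle: "nonneg (idle_sum P ls V)" if "good (rev ls @ V)" for V
    using Cons that ups by (blast intro: nonneg_diffD)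
  have moved: "nonneg (moved_sum P m ls V)" if "good (rev ls @ (m, True) # V)" for m V
    using Cons that by blast
  have idle': "nonneg (idle_sum P ((z, j) # ls) V - ssum ups (P @ rev ls @ (z, j) # V))"
    if "good (rev ls @ (z, j) # V)" for V j
  proof -
    have "nonneg (idle_sum P ls ((z, j) # V) - ssum ups (P @ rev ls @ (z, j) # V))"
      using Cons that by blast
    moreover have "nonneg (moved_sum P z ls V)"
      using that by (intro moved good_mark)
    ultimately have "nonneg ((idle_sum P ls ((z, j) # V) - ssum ups (P @ rev ls @ (z, j) # V))
        + moved_sum P z ls V)" by (rule nonneg_add)
    then show ?thesis by (simp add: idle_sum_Cons add_diff_eq diff_add_eq)
  qed
  have "nonneg (moved_sum P m ((z, k) # ls) V)" if I: "good (rev ls @ (z, k) # (m, True) # V)" for m V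
  proof (cases "m < z")
    case True
    \<comment> \<open>In the old word \<open>z\<close> precedes \<open>V\<close>, so with
      \<open>lo\<close> as 1 and \<open>z\<close> as 4 every 2 in \<open>V\<close> is already
      marked, as the swap requires.\<close>
    have J: "good (rev ls @ (m, True) # (z, k) # V)"
    proof -
      have "marked_423 lo ((z, k) # (m, True) # V)"
        using I marked_423_append unfolding good_def by blast
      then have "marked_23 lo z V" by simp
      then show ?thesis
        using I True marked_1423_swap[of m z lo V "P @ rev ls" k] marked_423_swap[of m z lo "rev ls" k V]
        unfolding good_def by auto
    qed
    have T: "good (rev ls @ (z, True) # (m, True) # V)" using I by (rule good_mark)
    have "nonneg (idle_sum P ((z, True) # ls) ((m, True) # V))"
      using idle'[OF T] ups[OF T] by (rule nonneg_diffD)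
    moreover have "nonneg (idle_sum P ls ((m, True) # (z, True) # V))"
      using good_mark[of "rev ls @ [(m, True)]" z k V] J by (intro idle) simp
    moreover have "nonneg (moved_sum P m ls ((z, k) # V))"
      using J by (rule moved)
    ultimately show ?thesis
      unfolding moved_sum_Cons_less[OF True] by (intro nonneg_add nonneg_beta)
  next
    case False
    then have zm: "z \<le> m" by simp
    show ?thesis
    proof (cases k)
      case False
      \<comment> \<open>No unread letter exceeds \<open>m\<close>, so \<open>m\<close> cannot move
        even when \<open>z\<close> is absent, and the negative term vanishes.\<close>
      then have "\<forall>y\<in>fst ` set (rev ls). y \<le> m"
        using I zm marked_423_below[of lo "rev ls" z "(m, True) # V" m True] unfolding good_def by auto
      then show ?thesis using zm False by (simp add: moved_sum_Cons_le moved_sum_eq_0)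
    qed (use zm in \<open>simp add: moved_sum_Cons_le\<close>)
  qed
  with idle' show ?case by (simp add: c)
qed

lemma ssum_ups_nonneg:
  "distinct (map fst ws) \<Longrightarrow> marked_1423 ws \<Longrightarrow> nonneg (ssum ups ws)"
proof (induction "length ws" arbitrary: ws)
  case 0
  then show ?case by (simp add: ups_def nonneg_def)
next
  case (Suc n)
  define a where "a = Min (fst ` set ws)"
  have "fst ` set ws \<noteq> {}" using Suc.hyps(2) by auto
  then have "a \<in> fst ` set ws" unfolding a_def by (intro Min_in) auto
  then obtain k where "(a, k) \<in> set ws" by auto
  then obtain P Q where ws: "ws = P @ (a, k) # Q" by (meson split_list)
  have less: "\<forall>y\<in>fst ` (set P \<union> set Q). a < y"
  proof
    fix y assume y: "y \<in> fst ` (set P \<union> set Q)"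
    then have "y \<in> fst ` set ws" by (auto simp: ws)
    then have "a \<le> y" unfolding a_def by (intro Min_le) auto
    moreover have "a \<noteq> y" using Suc.prems(1) y by (auto simp: ws)
    ultimately show "a < y" by simp
  qed
  have PQ: "distinct (map fst (P @ Q))" "marked_1423 (P @ Q)" "n = length (P @ Q)"
    using Suc.prems Suc.hyps(2) marked_1423_delete unfolding ws by auto
  have "marked_423 a Q" using Suc.prems(2) marked_1423_append[of P "(a, k) # Q"] unfolding ws by simp
  moreover have "\<forall>y\<in>fst ` set Q. a \<le> y" using less by (simp add: less_imp_le)
  ultimately have diff: "nonneg (idle_sum P (rev Q) [] - ssum ups (P @ Q))"
    using idle_moved_nonneg[where n = n and P = P and lo = a and ls = "rev Q",
        OF Suc.hyps(1)[OF sym], THEN conjunct1, THEN spec, of "[]"] PQ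
    by simp
  moreover have "nonneg (ssum ups (P @ Q))" using PQ(3,1,2) by (rule Suc.hyps(1))
  ultimately have "nonneg (idle_sum P (rev Q) [])" by (rule nonneg_diffD)
  \<comment> \<open>An unmarked \<open>a\<close> leaves the difference; a marked \<open>a\<close>
    leaves \<open>idle_sum\<close> alone.\<close>
  with diff show ?case
    unfolding ws ssum_ups_split_min[OF less] by simp
qed

section \<open>From \<open>cw\<close> and pattern avoidance to signed sums\<close>

lemma cw_eq_ssum:
  assumes "distinct w"
  shows "cw w = ssum ups (map (\<lambda>x. (x, False)) w)"
proof -
  have "(\<Sum>S\<in>Pow {..<length w}. (- 1) ^ (length w - card S) * f (nths w S))
      = ssum f (map (\<lambda>x. (x, False)) w)" for f :: "nat list \<Rightarrow> int poly"
  proof (induction w arbitrary: f)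
    case (Cons a w)
    let ?T = "Pow {..<length w}" and ?g = "\<lambda>S. insert 0 (Suc ` S)"
    \<comment> \<open>The bound on \<open>card S\<close> keeps the truncated subtraction in the
      exponent exact.\<close>
    have card: "card (Suc ` S) = card S" "card (?g S) = Suc (card S)" "card S \<le> length w"
      if "S \<in> ?T" for S
      using that card_mono[of "{..<length w}" S] finite_subset[of S "{..<length w}"]
      by (auto simp: card_image card_insert_if)
    have shift: "nths (a # w) (Suc ` S) = nths w S" "nths (a # w) (?g S) = a # nths w S" for S
      by (simp_all add: nths_Cons image_iff)
    define h where "h S = (- 1) ^ (length (a # w) - card S) * f (nths (a # w) S)" for S
    \<comment> \<open>The subsets avoiding position 0; adding 0 to them gives the others, matching
      the two terms of \<open>ssum\<close>.\<close>
    let ?P = "image Suc ` ?T"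
    have "{..<length (a # w)} = insert 0 (Suc ` {..<length w})"
      by (simp add: lessThan_Suc_eq_insert_0)
    moreover have "Pow (Suc ` {..<length w}) = ?P"
      by (rule image_Pow_surj[OF refl, symmetric])
    ultimately have "Pow {..<length (a # w)} = ?P \<union> insert 0 ` ?P"
      by (simp only: Pow_insert)
    moreover have "?P \<inter> insert 0 ` ?P = {}" by auto
    ultimately have "sum h (Pow {..<length (a # w)}) = sum h ?P + sum h (insert 0 ` ?P)"
      by (simp only: sum.union_disjoint finite_imageI finite_Pow_iff finite_lessThan)
    also have "sum h (insert 0 ` ?P) = sum (h \<circ> insert 0) ?P"
    proof (rule sum.reindex, rule inj_onI)
      fix A B assume "A \<in> ?P" "B \<in> ?P" "insert 0 A = insert 0 B"
      moreover from this have "0 \<notin> A" "0 \<notin> B" by auto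
      ultimately show "A = B" by (simp add: insert_ident)
    qed
    also have "sum h ?P = (\<Sum>S\<in>?T. h (Suc ` S))"
      by (subst sum.reindex) (simp_all add: inj_image_eq_iff inj_on_def)
    also have "sum (h \<circ> insert 0) ?P = (\<Sum>S\<in>?T. h (?g S))"
      by (subst sum.reindex) (simp_all add: inj_image_eq_iff inj_on_def)
    finally have "(\<Sum>S\<in>Pow {..<length (a # w)}. h S)
       = (\<Sum>S\<in>?T. h (Suc ` S)) + (\<Sum>S\<in>?T. h (?g S))" .
    moreover have "h (Suc ` S) = - ((- 1) ^ (length w - card S) * f (nths w S))"
      "h (?g S) = (- 1) ^ (length w - card S) * f (a # nths w S)" if "S \<in> ?T" for S
      using card[OF that] by (simp_all add: h_def shift Suc_diff_le)
    ultimately have "(\<Sum>S\<in>Pow {..<length (a # w)}. h S)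
       = - (\<Sum>S\<in>?T. (- 1) ^ (length w - card S) * f (nths w S))
       + (\<Sum>S\<in>?T. (- 1) ^ (length w - card S) * f (a # nths w S))"
      by (simp add: sum_negf)
    also have "\<dots> = ssum f (map (\<lambda>x. (x, False)) (a # w))"
      using Cons.IH[of f] Cons.IH[of "\<lambda>v. f (a # v)"] by simp
    finally show ?case by (simp add: h_def)
  qed simp
  from this[of ups] assms show ?thesis
    by (simp add: cw_def Upsilon_std distinct_nthsI)
qed

text \<open>With no letter marked, the invariant amounts to avoidance; the three nested inductions
  fix the 1, the 4 and the 2 in turn.\<close>

lemma marked_1423I:
  assumes "distinct w" and "\<And>a y z m. subseq [a, y, z, m] w \<Longrightarrow> \<not> (a < z \<and> z < m \<and> m < y)"
  shows "marked_1423 (map (\<lambda>x. (x, False)) w)"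
proof -
  have 2: "marked_23 a y (map (\<lambda>x. (x, False)) w)"
    if "distinct (a # w)" "\<And>z m. subseq [z, m] w \<Longrightarrow> \<not> (a < z \<and> z < m \<and> m < y)" for a y w
    using that
  proof (induction w)
    case (Cons z w)
    \<comment> \<open>Distinctness makes the comparisons strict.\<close>
    have "\<not> (a \<le> z \<and> z \<le> m \<and> m < y)" if "m \<in> set w" for m
      using Cons.prems(1) Cons.prems(2)[of z m] that by (auto simp: subseq_singleton_left)
    moreover have "marked_23 a y (map (\<lambda>x. (x, False)) w)"
      using Cons.prems(1) by (intro Cons.IH Cons.prems(2) list_emb_Cons) auto
    ultimately show ?case by auto
  qed simp
  have 3: "marked_423 a (map (\<lambda>x. (x, False)) w)"
    if "distinct (a # w)" "\<And>y z m. subseq [y, z, m] w \<Longrightarrow> \<not> (a < z \<and> z < m \<and> m < y)" for a w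
    using that
  proof (induction w)
    case (Cons y w)
    have "marked_23 a y (map (\<lambda>x. (x, False)) w)"
      using Cons.prems(1) Cons.prems(2)[of y] by (intro 2) auto
    moreover have "marked_423 a (map (\<lambda>x. (x, False)) w)"
      using Cons.prems(1) by (intro Cons.IH Cons.prems(2) list_emb_Cons) auto
    ultimately show ?case by simp
  qed simp
  show ?thesis
    using assms
  proof (induction w)
    case (Cons a w)
    have "marked_423 a (map (\<lambda>x. (x, False)) w)"
      using Cons.prems(1) Cons.prems(2)[of a] by (intro 3) auto
    moreover have "marked_1423 (map (\<lambda>x. (x, False)) w)"
      using Cons.prems(1) by (intro Cons.IH Cons.prems(2) list_emb_Cons) auto
    ultimately show ?case by simp
  qed simp
qed

lemma std_1423:
  assumes "a < z" "z < m" "m < (y :: nat)"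
  shows "std [a, y, z, m] = [1, 4, 2, 3]"
proof -
  have "{x \<in> set [a, y, z, m]. x \<le> a} = {a}" "{x \<in> set [a, y, z, m]. x \<le> y} = {a, z, m, y}"
    "{x \<in> set [a, y, z, m]. x \<le> z} = {a, z}" "{x \<in> set [a, y, z, m]. x \<le> m} = {a, z, m}"
    using assms by auto
  then show ?thesis using assms by (simp add: std_def)
qed

text \<open>Cuts the arbitrary index set from \<open>subseq_conv_nths\<close> down to the positions
  counted by \<open>patt_count\<close>.\<close>

lemma nths_restrict: "nths w (N \<inter> {..<length w}) = nths w N"
proof -
  have "i < length w" if "(a, i) \<in> set (zip w [0..<length w])" for a i
    using set_zip_rightD[OF that] by simp
  then have "snd x < length w" if "x \<in> set (zip w [0..<length w])" for x
    using that by (metis prod.collapse)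
  then show ?thesis
    unfolding nths_def by (intro arg_cong[where f = "map fst"] filter_cong) simp_all
qed

theorem theorem1p4:
  fixes w :: "nat list"
  assumes "is_perm w"
    and "patt_count [1, 4, 2, 3] w = 0"
  shows "\<forall>k. 0 \<le> coeff (cw w) k"
proof -
  have dist: "distinct w" using assms(1) by (simp add: is_perm_def)
  let ?A = "{S. S \<subseteq> {..<length w} \<and> std (nths w S) = [1, 4, 2, 3]}"
  \<comment> \<open>Excludes that \<open>card\<close> is 0 by its default value on infinite
    sets.\<close>
  have "finite ?A" by simp
  with assms(2) have empty: "?A = {}" unfolding patt_count_def by (simp only: card_0_eq)
  have "\<not> (a < z \<and> z < m \<and> m < y)" if sub: "subseq [a, y, z, m] w" for a y z m
  proof
    assume less: "a < z \<and> z < m \<and> m < y"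
    obtain N where "[a, y, z, m] = nths w N"
      using sub unfolding subseq_conv_nths by (rule exE)
    then have "std (nths w (N \<inter> {..<length w})) = [1, 4, 2, 3]"
      using less std_1423[of a z m y] by (simp only: nths_restrict)
    then have "N \<inter> {..<length w} \<in> ?A" by (intro CollectI conjI Int_lower2)
    then show False unfolding empty by (rule emptyE)
  qed
  then have "marked_1423 (map (\<lambda>x. (x, False)) w)"
    by (rule marked_1423I[OF dist])
  then have "nonneg (ssum ups (map (\<lambda>x. (x, False)) w))"
    using dist by (intro ssum_ups_nonneg) (simp_all add: o_def)
  then show ?thesis using dist by (simp add: cw_eq_ssum nonneg_def)
qed

end
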